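(* Let $M\subset G$ be the Cartan model of the symmetric space $G/K$ defined by $\sigma$ and let $A\in M$. Then $$\Omega_M(A):=\{B\in M : A+B \text{ is invertible}\}$$ is a contractible open subspace of $M$.
   Context: Let $\mathbb{K}$ be one of $\mathbb{R}$, $\mathbb{C}$, $\mathbb{H}$ (quaternions). For a matrix $A\in\mathbb{K}^{n\times n}$, $A^*$ denotes its conjugate transpose. $G$ is the identity component of the compact Lie group $O(n,\mathbb{K})=\{A\in\mathbb{K}^{n\times n}: AA^*=I\}$, i.e. $G=SO(n)$, $U(n)$ or $Sp(n)$. $\sigma\colon G\to G$ is an involutive automorphism which is the restriction of an involutive automorphism $\sigma\colon\mathbb{K}^{n\times n}\to\mathbb{K}^{n\times n}$ of unital (real) algebras satisfying $\sigma(Y^* )=\sigma(Y)^*$ for all $Y\in\mathbb{K}^{n\times n}$. $K=\{B\in G:\sigma(B)=B\}$ is the fixed point subgroup. The Cartan model of $G/K$ is the submanifold $M=\{B\sigma(B)^{-1}: B\in G\}\subset G$, i.e. the image of $G/K\to G$, $[B]\mapsto B\sigma(B)^{-1}$; it is the connected component of the identity of $N=\{B\in G:\sigma(B)=B^{-1}\}$. *)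

theory Defs
  imports "HOL-Analysis.Analysis"
begin

section \<open>Quaternions\<close>

text \<open>\<open>Quat a b c d\<close> stands for \<open>a + b i + c j + d k\<close>, with \<open>i\<^sup>2 = j\<^sup>2 = k\<^sup>2 = i j k = -1\<close>.\<close>

codatatype quat = Quat (qRe: real) (qI: real) (qJ: real) (qK: real)

lemma quat_eq_iff: "x = y \<longleftrightarrow> qRe x = qRe y \<and> qI x = qI y \<and> qJ x = qJ y \<and> qK x = qK y"
  by (auto intro: quat.expand)

instantiation quat :: ab_group_add
begin

primcorec zero_quat where
  "qRe 0 = 0" | "qI 0 = 0" | "qJ 0 = 0" | "qK 0 = 0"

primcorec plus_quat where
  "qRe (x + y) = qRe x + qRe y"
| "qI (x + y) = qI x + qI y"
| "qJ (x + y) = qJ x + qJ y"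
| "qK (x + y) = qK x + qK y"

primcorec uminus_quat where
  "qRe (- x) = - qRe x"
| "qI (- x) = - qI x"
| "qJ (- x) = - qJ x"
| "qK (- x) = - qK x"

primcorec minus_quat where
  "qRe (x - y) = qRe x - qRe y"
| "qI (x - y) = qI x - qI y"
| "qJ (x - y) = qJ x - qJ y"
| "qK (x - y) = qK x - qK y"

instance
  by standard (simp_all add: quat_eq_iff)

end

instantiation quat :: real_algebra_1
begin

primcorec one_quat where
  "qRe 1 = 1" | "qI 1 = 0" | "qJ 1 = 0" | "qK 1 = 0"

primcorec times_quat where
  "qRe (x * y) = qRe x * qRe y - qI x * qI y - qJ x * qJ y - qK x * qK y"
| "qI (x * y) = qRe x * qI y + qI x * qRe y + qJ x * qK y - qK x * qJ y"
| "qJ (x * y) = qRe x * qJ y - qI x * qK y + qJ x * qRe y + qK x * qI y"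
| "qK (x * y) = qRe x * qK y + qI x * qJ y - qJ x * qI y + qK x * qRe y"

primcorec scaleR_quat where
  "qRe (scaleR r x) = r * qRe x"
| "qI (scaleR r x) = r * qI x"
| "qJ (scaleR r x) = r * qJ x"
| "qK (scaleR r x) = r * qK x"

instance
  by standard (simp_all add: quat_eq_iff algebra_simps)

end

instantiation quat :: real_inner
begin

definition inner_quat :: "quat \<Rightarrow> quat \<Rightarrow> real"
  where "inner_quat x y = qRe x * qRe y + qI x * qI y + qJ x * qJ y + qK x * qK y"

definition norm_quat :: "quat \<Rightarrow> real"
  where "norm_quat x = sqrt (inner x x)"

definition sgn_quat :: "quat \<Rightarrow> quat"
  where "sgn_quat x = x /\<^sub>R norm x"

definition dist_quat :: "quat \<Rightarrow> quat \<Rightarrow> real"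
  where "dist_quat x y = norm (x - y)"

definition uniformity_quat :: "(quat \<times> quat) filter"
  where "uniformity_quat = (INF e\<in>{0 <..}. principal {(x, y). dist x y < e})"

definition open_quat :: "quat set \<Rightarrow> bool"
  where "open_quat U \<longleftrightarrow> (\<forall>x\<in>U. eventually (\<lambda>(x', y). x' = x \<longrightarrow> y \<in> U) uniformity)"

instance
proof
  fix x :: quat
  have sum4: "a * a + b * b + c * c + d * d = 0 \<longleftrightarrow> a = 0 \<and> b = 0 \<and> c = 0 \<and> d = 0"
    for a b c d :: real
    by (simp add: add_nonneg_eq_0_iff)
  show "inner x x = 0 \<longleftrightarrow> x = 0"
    unfolding inner_quat_def quat_eq_iff sum4 by simp
qed (simp_all add: inner_quat_def norm_quat_def sgn_quat_def dist_quat_def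
    uniformity_quat_def open_quat_def algebra_simps)

end

instantiation quat :: real_normed_div_algebra
begin

definition inverse_quat :: "quat \<Rightarrow> quat"
  where "inverse_quat x = Quat (qRe x) (- qI x) (- qJ x) (- qK x) /\<^sub>R inner x x"

definition divide_quat :: "quat \<Rightarrow> quat \<Rightarrow> quat"
  where "divide_quat x y = x * inverse y"

instance
proof
  fix x y :: quat
  assume "x \<noteq> 0"
  then have "inner x x \<noteq> 0"
    by simp
  moreover have "Quat (qRe x) (- qI x) (- qJ x) (- qK x) * x = inner x x *\<^sub>R 1"
    "x * Quat (qRe x) (- qI x) (- qJ x) (- qK x) = inner x x *\<^sub>R 1"
    by (simp_all add: quat_eq_iff inner_quat_def algebra_simps)
  ultimately show "inverse x * x = 1" "x * inverse x = 1"
    by (simp_all add: inverse_quat_def del: inner_eq_zero_iff)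
next
  fix x y :: quat
  show "x div y = x * inverse y"
    by (simp add: divide_quat_def)
  show "inverse (0::quat) = 0"
    by (simp add: inverse_quat_def)
  show "norm (x * y) = norm x * norm y"
    unfolding norm_quat_def real_sqrt_mult [symmetric] inner_quat_def times_quat.sel
    by (rule arg_cong [where f = sqrt]) algebra
qed

end

instantiation quat :: euclidean_space
begin

definition Basis_quat :: "quat set"
  where "Basis_quat = {Quat 1 0 0 0, Quat 0 1 0 0, Quat 0 0 1 0, Quat 0 0 0 1}"

instance
proof
  fix u v :: quat
  assume "u \<in> Basis" "v \<in> Basis"
  then show "inner u v = (if u = v then 1 else 0)"
    by (elim insertE emptyE Basis_quat_def [THEN equalityD1, THEN subsetD, elim_format])
       (simp_all add: inner_quat_def)
next
  fix x :: quat
  show "(\<forall>u\<in>Basis. inner x u = 0) \<longleftrightarrow> x = 0"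
    by (simp add: Basis_quat_def inner_quat_def quat_eq_iff [of x])
qed (simp_all add: Basis_quat_def)

end

section \<open>Scalars with a conjugation\<close>

class conj_scalar = real_normed_div_algebra + euclidean_space +
  fixes sconj :: "'a \<Rightarrow> 'a"
  assumes sconj_sconj [simp]: "sconj (sconj x) = x"
    and sconj_add: "sconj (x + y) = sconj x + sconj y"
    and sconj_scaleR: "sconj (r *\<^sub>R x) = r *\<^sub>R sconj x"
    and sconj_mult: "sconj (x * y) = sconj y * sconj x"
    and mult_sconj: "x * sconj x = (norm x)\<^sup>2 *\<^sub>R 1"

instantiation real :: conj_scalar
begin

definition sconj_real :: "real \<Rightarrow> real"
  where "sconj_real x = x"

instance
  by standard (simp_all add: sconj_real_def power2_eq_square)

end

instantiation complex :: conj_scalar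
begin

definition sconj_complex :: "complex \<Rightarrow> complex"
  where "sconj_complex = cnj"

instance
proof
  fix x :: complex
  show "x * sconj x = (norm x)\<^sup>2 *\<^sub>R 1"
    unfolding sconj_complex_def complex_norm_square [symmetric] scaleR_conv_of_real by (rule mult_1_right [symmetric])
qed (simp_all add: sconj_complex_def)

end

instantiation quat :: conj_scalar
begin

definition sconj_quat :: "quat \<Rightarrow> quat"
  where "sconj_quat x = Quat (qRe x) (- qI x) (- qJ x) (- qK x)"

instance
  by standard (simp_all add: sconj_quat_def quat_eq_iff power2_norm_eq_inner inner_quat_def algebra_simps)

end

section \<open>The Cartan model\<close>

definition conj_transpose :: "'a::conj_scalar^'n^'n \<Rightarrow> 'a^'n^'n"
  where "conj_transpose A = (\<chi> i j. sconj (A $ j $ i))"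

definition unitary_mats :: "('a::conj_scalar^'n^'n) set"
  where "unitary_mats = {A. A ** conj_transpose A = mat 1}"

text \<open>The identity component of \<^const>\<open>unitary_mats\<close>: \<open>SO(n)\<close>, \<open>U(n)\<close> or \<open>Sp(n)\<close>.\<close>

definition unitary_comp :: "('a::conj_scalar^'n^'n) set"
  where "unitary_comp = connected_component_set unitary_mats (mat 1)"

text \<open>Only real linearity is asked for, so over the complex numbers entrywise conjugation is allowed.\<close>

definition involutive_star_aut :: "('a::conj_scalar^'n^'n \<Rightarrow> 'a^'n^'n) \<Rightarrow> bool"
  where "involutive_star_aut \<sigma> \<longleftrightarrow>
    linear \<sigma> \<and> \<sigma> (mat 1) = mat 1 \<and> (\<forall>X Y. \<sigma> (X ** Y) = \<sigma> X ** \<sigma> Y) \<and>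
    (\<forall>X. \<sigma> (\<sigma> X) = X) \<and> (\<forall>Y. \<sigma> (conj_transpose Y) = conj_transpose (\<sigma> Y))"

text \<open>Such a \<open>\<sigma>\<close> always restricts to an automorphism of the group \<^const>\<open>unitary_comp\<close>, so this
  need not be demanded separately.\<close>

lemma involutive_star_aut_image_unitary_comp:
  fixes \<sigma> :: "'a::conj_scalar^'n^'n \<Rightarrow> 'a^'n^'n"
  assumes "involutive_star_aut \<sigma>"
  shows "\<sigma> ` unitary_comp = unitary_comp"
proof -
  have lin: "linear \<sigma>" and one: "\<sigma> (mat 1) = mat 1" and inv: "\<And>X. \<sigma> (\<sigma> X) = X"
    and mult: "\<And>X Y. \<sigma> (X ** Y) = \<sigma> X ** \<sigma> Y"
    and star: "\<And>Y. \<sigma> (conj_transpose Y) = conj_transpose (\<sigma> Y)"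
    using assms by (auto simp: involutive_star_aut_def)
  have sub: "\<sigma> ` unitary_comp \<subseteq> unitary_comp"
  proof
    fix Y assume "Y \<in> \<sigma> ` unitary_comp"
    then obtain B where B: "Y = \<sigma> B" "connected_component unitary_mats (mat 1) B"
      by (auto simp: unitary_comp_def)
    then obtain T where T: "connected T" "T \<subseteq> unitary_mats" "mat 1 \<in> T" "B \<in> T"
      by (auto simp: connected_component_def)
    have "continuous_on T \<sigma>"
      using lin by (intro linear_continuous_on) (simp only: linear_conv_bounded_linear)
    then have "connected (\<sigma> ` T)"
      using T(1) by (rule connected_continuous_image)
    moreover have "\<sigma> ` T \<subseteq> unitary_mats"
    proof
      fix Z assume "Z \<in> \<sigma> ` T"
      then obtain X where X: "X \<in> T" "Z = \<sigma> X"
        by (rule imageE)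
      have "\<sigma> (X ** conj_transpose X) = mat 1"
        using X(1) T(2) one by (auto simp: unitary_mats_def)
      then show "Z \<in> unitary_mats"
        by (simp only: X(2) unitary_mats_def mem_Collect_eq mult star)
    qed
    moreover have "mat 1 \<in> \<sigma> ` T"
      by (rule rev_image_eqI [OF T(3)]) (simp only: one)
    ultimately show "Y \<in> unitary_comp"
      using B(1) T(4) by (auto simp: unitary_comp_def connected_component_def)
  qed
  have "unitary_comp \<subseteq> \<sigma> ` unitary_comp"
  proof
    fix B :: "'a^'n^'n" assume "B \<in> unitary_comp"
    then have "\<sigma> B \<in> unitary_comp"
      using sub by blast
    then show "B \<in> \<sigma> ` unitary_comp"
      by (rule rev_image_eqI) (simp only: inv)
  qed
  with sub show ?thesis
    by (rule subset_antisym)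
qed

text \<open>The image of the well-defined injection \<open>G/K \<rightarrow> G\<close>, \<open>[B] \<mapsto> B \<sigma>(B)\<^sup>-\<^sup>1\<close>, where \<open>G\<close> is
  \<^const>\<open>unitary_comp\<close> and \<open>K\<close> its subgroup of fixed points of \<open>\<sigma>\<close>.\<close>

definition cartan_model :: "('a::conj_scalar^'n^'n \<Rightarrow> 'a^'n^'n) \<Rightarrow> ('a^'n^'n) set"
  where "cartan_model \<sigma> = {B ** matrix_inv (\<sigma> B) | B. B \<in> unitary_comp}"

definition cartan_Omega :: "('a::conj_scalar^'n^'n \<Rightarrow> 'a^'n^'n) \<Rightarrow> 'a^'n^'n \<Rightarrow> ('a^'n^'n) set"
  where "cartan_Omega \<sigma> A = {B \<in> cartan_model \<sigma>. invertible (A + B)}"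

end

theory Submission
  imports Defs
begin

text \<open>
  For \<open>A = C \<sigma>(C)\<^sup>-\<^sup>1\<close> the map \<open>B \<mapsto> C B \<sigma>(C)\<^sup>-\<^sup>1\<close> preserves \<open>M\<close> and carries \<open>\<Omega>\<^sub>M(1)\<close> onto
  \<open>\<Omega>\<^sub>M(A)\<close>, so one may take \<open>A = 1\<close>. The Cayley transform \<open>X \<mapsto> (1 - X) (1 + X)\<^sup>-\<^sup>1\<close> is an involution
  on the matrices with \<open>1 + X\<close> invertible and exchanges \<open>\<Omega>\<^sub>M(1)\<close> with the vector space of all
  skew-Hermitian \<open>X\<close> with \<open>\<sigma>(X) = - X\<close>. The point is that the transform of such an \<open>X\<close> lies in
  \<open>M\<close> and not only in \<open>{B. \<sigma>(B) = B\<^sup>-\<^sup>1}\<close>: it is the square of the transform \<open>D\<close> of a matrix \<open>Y\<close>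
  from the same space with half the angles, and \<open>D\<^sup>2 = D \<sigma>(D)\<^sup>-\<^sup>1\<close>, where \<open>D\<close> is joined to \<open>1\<close> by the
  transforms of \<open>t Y\<close>.
\<close>

section \<open>Matrices over a finite-dimensional real algebra\<close>

text \<open>Even over noncommutative scalars the product is bilinear over the reals, and bilinear
  maps in finite dimension are bounded. This supplies the ring identities and the continuity of the
  product used throughout.\<close>

lemma bounded_bilinear_matrix_mult [bounded_bilinear]:
  "bounded_bilinear ((**) :: 'a::{real_algebra_1,euclidean_space}^'n^'n \<Rightarrow> 'a^'n^'n \<Rightarrow> 'a^'n^'n)"
proof -
  have "bilinear ((**) :: 'a^'n^'n \<Rightarrow> 'a^'n^'n \<Rightarrow> 'a^'n^'n)"
    unfolding bilinear_def
    by (intro conjI allI linearI)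
       (simp_all add: matrix_matrix_mult_def vec_eq_iff sum.distrib algebra_simps scaleR_sum_right)
  then show ?thesis
    by (simp add: bilinear_conv_bounded_bilinear)
qed

interpretation matrix_mult: bounded_bilinear
  "(**) :: 'a::{real_algebra_1,euclidean_space}^'n^'n \<Rightarrow> 'a^'n^'n \<Rightarrow> 'a^'n^'n"
  by (rule bounded_bilinear_matrix_mult)

lemmas matrix_ring_simps =
  matrix_mult.add_left matrix_mult.add_right matrix_mult.diff_left matrix_mult.diff_right
  matrix_mult.minus_left matrix_mult.minus_right matrix_mult.scaleR_left matrix_mult.scaleR_right
  matrix_mul_assoc [symmetric]

text \<open>Left multiplication by \<open>A\<close> is a real linear endomorphism of a
  finite-dimensional space, so injectivity gives surjectivity and a preimage \<open>B\<close> of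
  \<open>mat 1\<close>. Cancelling \<open>A\<close> in \<open>A ** (B ** A - mat 1) = 0\<close>
  shows that \<open>B\<close> is also a left inverse. No determinant enters, so quaternions are
  covered.\<close>

lemma invertible_if_inj:
  fixes A :: "'a::{real_algebra_1,euclidean_space}^'n^'n"
  assumes "\<And>Z :: 'a^'n^'n. A ** Z = 0 \<Longrightarrow> Z = 0"
  shows "invertible A"
proof -
  let ?f = "(**) A :: 'a^'n^'n \<Rightarrow> 'a^'n^'n"
  have lin: "linear ?f"
    by (rule bounded_linear.linear [OF matrix_mult.bounded_linear_right])
  then have "inj ?f"
    using assms by (simp add: linear_injective_0)
  then have "surj ?f"
    by (rule linear_inj_imp_surj [OF lin])
  then obtain B where B: "mat 1 = A ** B"
    by (rule surjE)
  have "A ** (B ** A - mat 1) = 0"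
    by (simp add: matrix_mult.diff_right matrix_mul_assoc B [symmetric])
  then have "B ** A - mat 1 = 0"
    by (rule assms)
  with B show ?thesis
    by (auto simp: invertible_def)
qed

text \<open>The equation makes left multiplication by \<open>B\<close> injective, so
  \<open>B\<close> has an inverse \<open>C\<close>, and associativity forces
  \<open>C = A\<close>.\<close>

lemma matrix_right_inverse_imp_left:
  fixes A B :: "'a::{real_algebra_1,euclidean_space}^'n^'n"
  assumes "A ** B = mat 1"
  shows "B ** A = mat 1"
proof -
  have "invertible B"
  proof (rule invertible_if_inj)
    fix Z :: "'a^'n^'n"
    assume "B ** Z = 0"
    then have "A ** B ** Z = 0"
      by (simp add: matrix_mul_assoc [symmetric])
    then show "Z = 0"
      by (simp add: assms)
  qed
  then obtain C where C: "B ** C = mat 1"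
    by (auto simp: invertible_def)
  have "A = A ** (B ** C)"
    by (simp add: C)
  also have "\<dots> = C"
    by (simp add: matrix_mul_assoc assms)
  finally show ?thesis
    by (simp add: C)
qed

lemma matrix_inv_inverse:
  assumes "invertible A"
  shows "A ** matrix_inv A = mat 1" "matrix_inv A ** A = mat 1"
proof -
  have "A ** matrix_inv A = mat 1 \<and> matrix_inv A ** A = mat 1"
    using assms unfolding invertible_def matrix_inv_def by (rule someI_ex)
  then show "A ** matrix_inv A = mat 1" "matrix_inv A ** A = mat 1"
    by auto
qed

lemma matrix_inv_unique_right:
  fixes A B :: "'a::{real_algebra_1,euclidean_space}^'n^'n"
  assumes "A ** B = mat 1"
  shows "invertible A" "matrix_inv A = B"
proof -
  have BA: "B ** A = mat 1"
    using assms by (rule matrix_right_inverse_imp_left)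
  with assms show inv: "invertible A"
    by (auto simp: invertible_def)
  have "matrix_inv A = (B ** A) ** matrix_inv A"
    by (simp add: BA)
  also have "\<dots> = B"
    using matrix_inv_inverse(1) [OF inv] by (simp add: matrix_mul_assoc [symmetric])
  finally show "matrix_inv A = B" .
qed

section \<open>Openness of the invertible matrices and continuity of inversion\<close>

lemma invertible_lower_bound_near:
  fixes A :: "'a::{real_algebra_1,euclidean_space}^'n^'n"
  assumes "invertible A"
  obtains d c where "d > 0" "c > 0"
    "\<And>B Z :: 'a^'n^'n. norm (B - A) < d \<Longrightarrow> norm Z \<le> c * norm (B ** Z)"
proof -
  obtain K where K: "K > 0"
      "\<And>(X :: 'a^'n^'n) (Y :: 'a^'n^'n). norm (X ** Y) \<le> norm X * norm Y * K"
    using matrix_mult.pos_bounded [where 'a = 'a and 'n = 'n] by auto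
  define R where "R = matrix_inv A"
  define r where "r = norm R * K"
  have "r \<ge> 0"
    using K(1) by (simp add: r_def)
  \<comment> \<open>Chosen so that \<open>(r + 1) * d * K = 1 / 2\<close>; the summand 1 keeps the
    denominator positive without \<open>r > 0\<close>.\<close>
  define d where "d = 1 / (2 * (r + 1) * K)"
  have d: "d > 0"
    using K(1) \<open>r \<ge> 0\<close> by (simp add: d_def)
  \<comment> \<open>Write \<open>Z = R ** (B ** Z - (B - A) ** Z)\<close>. The perturbation
    contributes at most half of \<open>norm Z\<close>, which is absorbed on the left and doubles the
    constant.\<close>
  have "norm Z \<le> 2 * (r + 1) * norm (B ** Z)" if "norm (B - A) < d" for B Z :: "'a^'n^'n"
  proof -
    have "norm Z = norm (R ** (A ** Z))"
      by (simp add: R_def matrix_mul_assoc matrix_inv_inverse [OF assms])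
    also have "A ** Z = B ** Z - (B - A) ** Z"
      by (simp add: matrix_mult.diff_left)
    also have "norm (R ** \<dots>) \<le> norm R * norm (B ** Z - (B - A) ** Z) * K"
      by (rule K(2))
    also have "\<dots> = r * norm (B ** Z - (B - A) ** Z)"
      by (simp add: r_def)
    also have "\<dots> \<le> (r + 1) * (norm (B ** Z) + d * norm Z * K)"
    proof (rule mult_mono)
      have "norm ((B - A) ** Z) \<le> norm (B - A) * norm Z * K"
        by (rule K(2))
      also have "\<dots> \<le> d * norm Z * K"
        using that K(1) by (intro mult_right_mono) auto
      finally show "norm (B ** Z - (B - A) ** Z) \<le> norm (B ** Z) + d * norm Z * K"
        using norm_triangle_ineq4 [of "B ** Z" "(B - A) ** Z"] by linarith
    qed (use \<open>r \<ge> 0\<close> in auto)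
    also have "\<dots> = (r + 1) * norm (B ** Z) + ((r + 1) * d * K) * norm Z"
      by (simp add: algebra_simps)
    also have "(r + 1) * d * K = 1 / 2"
      using K(1) \<open>r \<ge> 0\<close> by (simp add: d_def add_nonneg_eq_0_iff)
    finally show ?thesis
      by (simp add: algebra_simps)
  qed
  then show ?thesis
    using d \<open>r \<ge> 0\<close> by (intro that [of d "2 * (r + 1)"]) auto
qed

lemma open_invertible: "open {A :: 'a::{real_algebra_1,euclidean_space}^'n^'n. invertible A}"
  unfolding open_dist
proof (intro ballI, clarify)
  fix A :: "'a^'n^'n"
  assume "invertible A"
  then obtain d c where dc: "d > 0" "c > 0"
    "\<And>B Z :: 'a^'n^'n. norm (B - A) < d \<Longrightarrow> norm Z \<le> c * norm (B ** Z)"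
    using invertible_lower_bound_near by blast
  have "invertible B" if "dist B A < d" for B
  proof (rule invertible_if_inj)
    fix Z :: "'a^'n^'n"
    assume "B ** Z = 0"
    then show "Z = 0"
      using dc(3) [of B Z] that by (simp add: dist_norm)
  qed
  with dc(1) show "\<exists>e>0. \<forall>B. dist B A < e \<longrightarrow> B \<in> {A. invertible A}"
    by auto
qed

lemma continuous_on_matrix_inv_invertible:
  "continuous_on {A :: 'a::{real_algebra_1,euclidean_space}^'n^'n. invertible A} matrix_inv"
proof (rule continuous_onI)
  fix A :: "'a^'n^'n" and e :: real
  assume "A \<in> {A. invertible A}" and e: "e > 0"
  then have inv: "invertible A"
    by simp
  then obtain d c where dc: "d > 0" "c > 0"
    "\<And>B Z :: 'a^'n^'n. norm (B - A) < d \<Longrightarrow> norm Z \<le> c * norm (B ** Z)"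
    using invertible_lower_bound_near by blast
  obtain K where K: "K > 0"
      "\<And>(X :: 'a^'n^'n) (Y :: 'a^'n^'n). norm (X ** Y) \<le> norm X * norm Y * K"
    using matrix_mult.pos_bounded [where 'a = 'a and 'n = 'n] by auto
  define q where "q = c * (norm (matrix_inv A) * K)"
  have q: "q \<ge> 0"
    using dc(2) K(1) by (simp add: q_def)
  have "dist (matrix_inv B) (matrix_inv A) \<le> e"
    if B: "invertible B" and near: "dist B A < min d (e / (q + 1))" for B
  proof -
    \<comment> \<open>Resolvent identity: the lower bound for \<open>B\<close>, applied to the
      difference of the inverses, now estimates that difference by a multiple of
      \<open>norm (A - B)\<close>.\<close>
    have diff: "B ** (matrix_inv B - matrix_inv A) = (A - B) ** matrix_inv A"
      by (simp add: matrix_mult.diff_left matrix_mult.diff_right matrix_inv_inverse [OF B]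
          matrix_inv_inverse [OF inv])
    have "dist (matrix_inv B) (matrix_inv A) \<le> c * norm ((A - B) ** matrix_inv A)"
      using dc(3) [of B] near by (simp add: dist_norm flip: diff)
    also have "\<dots> \<le> c * (norm (A - B) * norm (matrix_inv A) * K)"
      using dc(2) by (intro mult_left_mono K(2)) simp
    also have "\<dots> = q * dist B A"
      by (simp add: q_def dist_norm norm_minus_commute)
    also have "\<dots> \<le> (q + 1) * (e / (q + 1))"
      using near q by (intro mult_mono) auto
    also have "\<dots> = e"
      using q by simp
    finally show ?thesis .
  qed
  moreover have "min d (e / (q + 1)) > 0"
    using dc(1) e q by simp
  ultimately show "\<exists>d>0. \<forall>B\<in>{A. invertible A}. dist B A < d \<longrightarrow>
      dist (matrix_inv B) (matrix_inv A) \<le> e"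
    by blast
qed

lemma continuous_on_matrix_inv [continuous_intros]:
  fixes f :: "'b::topological_space \<Rightarrow> 'a::{real_algebra_1,euclidean_space}^'n^'n"
  assumes "continuous_on S f" and "\<And>x. x \<in> S \<Longrightarrow> invertible (f x)"
  shows "continuous_on S (\<lambda>x. matrix_inv (f x))"
  using assms
  by (intro continuous_on_compose2 [OF continuous_on_matrix_inv_invertible]) auto

section \<open>Conjugate transposition\<close>

lemma sconj_zero: "sconj (0::'a::conj_scalar) = 0"
  using sconj_scaleR [of 0 0] by simp

text \<open>Polarization of the multiplicative norm: for nonzero \<open>a\<close>, compare the cross
  terms in \<open>norm (a * x + y) = norm a * norm (x + inverse a * y)\<close> after squaring, and
  use that \<open>sconj a\<close> is \<open>inverse a\<close> scaled by the squared norm of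
  \<open>a\<close>.\<close>

lemma inner_mult_left_sconj: "inner (a * x) y = inner x (sconj a * y)"
  for a x y :: "'a::conj_scalar"
proof (cases "a = 0")
  case True
  then show ?thesis
    by (simp add: sconj_zero)
next
  case False
  have "inverse a * (a * sconj a) = inverse a * ((norm a)\<^sup>2 *\<^sub>R 1)"
    by (simp only: mult_sconj)
  then have sc: "sconj a = (norm a)\<^sup>2 *\<^sub>R inverse a"
    using False by (simp add: mult.assoc [symmetric])
  have "(norm (a * x + y))\<^sup>2 = (norm (a * (x + inverse a * y)))\<^sup>2"
    using False by (simp add: distrib_left mult.assoc [symmetric])
  also have "\<dots> = (norm a)\<^sup>2 * (norm (x + inverse a * y))\<^sup>2"
    by (simp add: norm_mult power_mult_distrib)
  finally have "(norm (a * x))\<^sup>2 + 2 * inner (a * x) y + (norm y)\<^sup>2 =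
      (norm a)\<^sup>2 * ((norm x)\<^sup>2 + 2 * inner x (inverse a * y) + (norm (inverse a * y))\<^sup>2)"
    by (simp only: power2_norm_eq_inner inner_add_left inner_add_right)
       (simp add: inner_commute algebra_simps)
  moreover have "(norm a)\<^sup>2 * (norm (inverse a * y))\<^sup>2 = (norm y)\<^sup>2"
  proof -
    have "norm a * norm (inverse a) = 1"
      using False by (simp flip: norm_mult)
    then have "(norm a)\<^sup>2 * (norm (inverse a))\<^sup>2 = 1"
      by (simp flip: power_mult_distrib)
    then show ?thesis
      by (simp add: norm_mult power_mult_distrib)
  qed
  ultimately have "inner (a * x) y = (norm a)\<^sup>2 * inner x (inverse a * y)"
    by (simp add: distrib_left norm_mult [of a x] power_mult_distrib)
  then show ?thesis
    by (simp add: sc)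
qed

lemma sconj_one: "sconj (1::'a::conj_scalar) = 1"
proof -
  have "sconj (sconj 1) = sconj (sconj (1::'a)) * sconj 1"
    by (metis mult_1_left sconj_mult)
  then show ?thesis
    by simp
qed

lemma sconj_sum: "sconj (sum f S) = (\<Sum>i\<in>S. sconj (f i))"
  for f :: "'b \<Rightarrow> 'a::conj_scalar"
  by (induction S rule: infinite_finite_induct) (simp_all add: sconj_zero sconj_add)

lemma linear_conj_transpose: "linear (conj_transpose :: 'a::conj_scalar^'n^'n \<Rightarrow> 'a^'n^'n)"
  by (intro linearI) (simp_all add: conj_transpose_def vec_eq_iff sconj_add sconj_scaleR)

lemma conj_transpose_conj_transpose [simp]: "conj_transpose (conj_transpose A) = A"
  by (simp add: conj_transpose_def vec_eq_iff)

lemma conj_transpose_mat_one [simp]: "conj_transpose (mat 1) = mat 1"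
  by (simp add: conj_transpose_def mat_def vec_eq_iff sconj_zero sconj_one)

lemma conj_transpose_mult: "conj_transpose (A ** B) = conj_transpose B ** conj_transpose A"
  by (simp add: conj_transpose_def matrix_matrix_mult_def vec_eq_iff sconj_sum sconj_mult)

lemmas conj_transpose_linear_simps =
  linear_add [OF linear_conj_transpose] linear_diff [OF linear_conj_transpose]
  linear_neg [OF linear_conj_transpose] linear_cmul [OF linear_conj_transpose]

lemma continuous_on_conj_transpose [continuous_intros]:
  fixes f :: "'b::topological_space \<Rightarrow> 'a::conj_scalar^'n^'n"
  assumes "continuous_on S f"
  shows "continuous_on S (\<lambda>x. conj_transpose (f x))"
proof -
  have "bounded_linear (conj_transpose :: 'a^'n^'n \<Rightarrow> 'a^'n^'n)"
    using linear_conj_transpose by (simp only: linear_conv_bounded_linear)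
  then show ?thesis
    using assms by (rule bounded_linear.continuous_on)
qed

text \<open>The conjugate transpose is the adjoint of left multiplication for the real Frobenius
  inner product: apply the scalar adjunction entrywise and reorder the triple sum. Skewness and
  positivity are exploited through this identity.\<close>

lemma inner_matrix_mult_left: "inner (A ** B) C = inner B (conj_transpose A ** C)"
  for A B C :: "'a::conj_scalar^'n^'n"
proof -
  have "inner (A ** B) C =
      (\<Sum>i\<in>UNIV. \<Sum>j\<in>UNIV. \<Sum>k\<in>UNIV. inner (B $ k $ j) (sconj (A $ i $ k) * C $ i $ j))"
    by (simp add: inner_vec_def matrix_matrix_mult_def inner_sum_left inner_mult_left_sconj)
  also have "\<dots> =
      (\<Sum>i\<in>UNIV. \<Sum>k\<in>UNIV. \<Sum>j\<in>UNIV. inner (B $ k $ j) (sconj (A $ i $ k) * C $ i $ j))"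
    by (intro sum.cong refl sum.swap)
  also have "\<dots> =
      (\<Sum>k\<in>UNIV. \<Sum>i\<in>UNIV. \<Sum>j\<in>UNIV. inner (B $ k $ j) (sconj (A $ i $ k) * C $ i $ j))"
    by (rule sum.swap)
  also have "\<dots> =
      (\<Sum>k\<in>UNIV. \<Sum>j\<in>UNIV. \<Sum>i\<in>UNIV. inner (B $ k $ j) (sconj (A $ i $ k) * C $ i $ j))"
    by (intro sum.cong refl sum.swap)
  also have "\<dots> = inner B (conj_transpose A ** C)"
    by (simp add: inner_vec_def matrix_matrix_mult_def inner_sum_right conj_transpose_def)
  finally show ?thesis .
qed

section \<open>The unitary group\<close>

lemma unitary_matsD:
  assumes "A \<in> unitary_mats"
  shows "A ** conj_transpose A = mat 1" "conj_transpose A ** A = mat 1"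
    "invertible A" "matrix_inv A = conj_transpose A"
proof -
  show A: "A ** conj_transpose A = mat 1"
    using assms by (simp add: unitary_mats_def)
  then show "conj_transpose A ** A = mat 1"
    by (rule matrix_right_inverse_imp_left)
  from A show "invertible A" "matrix_inv A = conj_transpose A"
    by (rule matrix_inv_unique_right)+
qed

lemma unitary_mats_mult: "A \<in> unitary_mats \<Longrightarrow> B \<in> unitary_mats \<Longrightarrow> A ** B \<in> unitary_mats"
proof -
  assume A: "A \<in> unitary_mats" and B: "B \<in> unitary_mats"
  have "A ** B ** conj_transpose (A ** B) = A ** (B ** conj_transpose B) ** conj_transpose A"
    by (simp add: conj_transpose_mult matrix_mul_assoc)
  then show ?thesis
    using unitary_matsD(1) [OF A] unitary_matsD(1) [OF B] by (simp add: unitary_mats_def)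
qed

lemma unitary_comp_subset: "unitary_comp \<subseteq> unitary_mats"
  by (simp add: unitary_comp_def connected_component_subset)

lemma mat_one_unitary_comp: "mat 1 \<in> unitary_comp"
  by (simp add: unitary_comp_def unitary_mats_def)

text \<open>Serves to show that the identity component is a subgroup, with \<open>T\<close> one of
  its images, and that it contains Cayley transforms, with \<open>T\<close> a path.\<close>

lemma unitary_comp_memI:
  assumes "connected T" "T \<subseteq> unitary_mats" "A \<in> T" "A \<in> unitary_comp" "B \<in> T"
  shows "B \<in> unitary_comp"
proof -
  have "connected_component unitary_mats A B"
    using assms by (auto simp: connected_component_def)
  moreover have "connected_component unitary_mats (mat 1) A"
    using assms by (simp add: unitary_comp_def)
  ultimately show ?thesis
    unfolding unitary_comp_def mem_Collect_eq by (blast intro: connected_component_trans)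
qed

lemma connected_unitary_comp: "connected unitary_comp"
  by (simp add: unitary_comp_def)

lemma unitary_comp_mult:
  fixes A B :: "'a::conj_scalar^'n^'n"
  assumes "A \<in> unitary_comp" "B \<in> unitary_comp"
  shows "A ** B \<in> unitary_comp"
proof (rule unitary_comp_memI)
  show "connected ((\<lambda>B. A ** B) ` (unitary_comp :: ('a^'n^'n) set))"
    by (intro connected_continuous_image connected_unitary_comp continuous_intros)
  show "(\<lambda>B. A ** B) ` unitary_comp \<subseteq> unitary_mats"
    using assms(1) unitary_comp_subset unitary_mats_mult by blast
  show "A \<in> (\<lambda>B. A ** B) ` (unitary_comp :: ('a^'n^'n) set)"
    using mat_one_unitary_comp by (rule rev_image_eqI) simp
qed (use assms in auto)

lemma conj_transpose_unitary_comp: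
  fixes A :: "'a::conj_scalar^'n^'n"
  assumes "A \<in> unitary_comp"
  shows "conj_transpose A \<in> unitary_comp"
proof (rule unitary_comp_memI)
  show "connected (conj_transpose ` (unitary_comp :: ('a^'n^'n) set))"
    by (intro connected_continuous_image connected_unitary_comp continuous_intros)
  show "conj_transpose ` (unitary_comp :: ('a^'n^'n) set) \<subseteq> unitary_mats"
  proof clarify
    fix B :: "'a^'n^'n"
    assume "B \<in> unitary_comp"
    then have "B \<in> unitary_mats"
      using unitary_comp_subset by blast
    from unitary_matsD(2) [OF this] show "conj_transpose B \<in> unitary_mats"
      by (simp add: unitary_mats_def)
  qed
  show "mat 1 \<in> conj_transpose ` (unitary_comp :: ('a^'n^'n) set)"
    using mat_one_unitary_comp by (rule rev_image_eqI) simp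
qed (use assms mat_one_unitary_comp in auto)

section \<open>The Cayley transform\<close>

definition cayley :: "'a::conj_scalar^'n^'n \<Rightarrow> 'a^'n^'n"
  where "cayley X = (mat 1 - X) ** matrix_inv (mat 1 + X)"

lemma matrix_inv_commute:
  assumes "invertible A" "A ** B = B ** A"
  shows "matrix_inv A ** B = B ** matrix_inv A"
proof -
  have "matrix_inv A ** B = matrix_inv A ** (B ** A) ** matrix_inv A"
    using matrix_inv_inverse [OF assms(1)] by (simp flip: matrix_mul_assoc)
  also have "\<dots> = (matrix_inv A ** A) ** B ** matrix_inv A"
    by (simp add: matrix_mul_assoc flip: assms(2))
  also have "\<dots> = B ** matrix_inv A"
    using matrix_inv_inverse [OF assms(1)] by simp
  finally show ?thesis .
qed

lemma cayley_mult_left: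
  assumes "invertible (mat 1 + X)"
  shows "cayley X ** (mat 1 + X) = mat 1 - X"
  using matrix_inv_inverse [OF assms] by (simp add: cayley_def flip: matrix_mul_assoc)

text \<open>Lets identities between transforms be checked by multiplying out, with no inverse in
  sight.\<close>

lemma cayley_eqI:
  assumes "invertible (mat 1 + X)" "C ** (mat 1 + X) = mat 1 - X"
  shows "cayley X = C"
  using matrix_inv_inverse [OF assms(1)]
  by (simp add: cayley_def assms(2) [symmetric] flip: matrix_mul_assoc)

lemma cayley_commute:
  assumes "invertible (mat 1 + X)" "X ** Y = Y ** X"
  shows "cayley X ** Y = Y ** cayley X"
proof -
  have "matrix_inv (mat 1 + X) ** Y = Y ** matrix_inv (mat 1 + X)"
    using assms by (intro matrix_inv_commute) (simp_all add: matrix_ring_simps)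
  moreover have "(mat 1 - X) ** Y = Y ** (mat 1 - X)"
    using assms(2) by (simp add: matrix_ring_simps)
  ultimately show ?thesis
    unfolding cayley_def by (metis matrix_mul_assoc)
qed

text \<open>The first identity exhibits the inverse of \<open>mat 1 + cayley X\<close> up to the
  factor 2; dividing the second by the first shows that the transform is an involution.\<close>

lemma one_plus_cayley:
  assumes "invertible (mat 1 + X)"
  shows "(mat 1 + cayley X) ** (mat 1 + X) = 2 *\<^sub>R mat 1"
    and "(mat 1 - cayley X) ** (mat 1 + X) = 2 *\<^sub>R X"
  by (simp_all add: matrix_mult.add_left [of "mat 1"] matrix_mult.diff_left [of "mat 1"]
      cayley_mult_left [OF assms] scaleR_2)

lemma invertible_one_plus_cayley:
  assumes "invertible (mat 1 + X)"
  shows "invertible (mat 1 + cayley X)"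
proof (rule matrix_inv_unique_right)
  show "(mat 1 + cayley X) ** ((1/2) *\<^sub>R (mat 1 + X)) = mat 1"
    by (simp add: matrix_mult.scaleR_right one_plus_cayley [OF assms])
qed

lemma cayley_cayley:
  assumes "invertible (mat 1 + X)"
  shows "cayley (cayley X) = X"
proof (rule cayley_eqI)
  have "(X ** (mat 1 + cayley X)) ** (mat 1 + X) = (mat 1 - cayley X) ** (mat 1 + X)"
    by (simp add: one_plus_cayley [OF assms] matrix_mult.scaleR_right flip: matrix_mul_assoc)
  then have "(X ** (mat 1 + cayley X)) ** (mat 1 + X) ** matrix_inv (mat 1 + X) =
      (mat 1 - cayley X) ** (mat 1 + X) ** matrix_inv (mat 1 + X)"
    by (rule arg_cong)
  then show "X ** (mat 1 + cayley X) = mat 1 - cayley X"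
    using matrix_inv_inverse [OF assms] by (simp flip: matrix_mul_assoc)
qed (rule invertible_one_plus_cayley [OF assms])

lemma conj_transpose_invertible:
  assumes "invertible A"
  shows "invertible (conj_transpose A)"
proof (rule matrix_inv_unique_right)
  show "conj_transpose A ** conj_transpose (matrix_inv A) = mat 1"
    using matrix_inv_inverse [OF assms] by (simp flip: conj_transpose_mult)
qed

lemma conj_transpose_cayley:
  assumes "invertible (mat 1 + X)"
  shows "conj_transpose (cayley X) = cayley (conj_transpose X)"
proof (rule sym, rule cayley_eqI)
  show "invertible (mat 1 + conj_transpose X)"
    using conj_transpose_invertible [OF assms] by (simp add: conj_transpose_linear_simps)
  have "(mat 1 + X) ** cayley X = mat 1 - X"
    using cayley_mult_left [OF assms] cayley_commute [OF assms, of "mat 1 + X"]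
    by (simp add: matrix_ring_simps)
  then have "conj_transpose ((mat 1 + X) ** cayley X) = mat 1 - conj_transpose X"
    by (simp add: conj_transpose_linear_simps)
  then show "conj_transpose (cayley X) ** (mat 1 + conj_transpose X) = mat 1 - conj_transpose X"
    by (simp add: conj_transpose_mult conj_transpose_linear_simps)
qed

text \<open>Multiplying numerator and denominator of the transform of \<open>A\<close> by
  \<open>B\<close> exchanges the two terms in each, which only flips the sign. This is how unitarity
  becomes skewness.\<close>

lemma cayley_inverse:
  assumes "A ** B = mat 1" "invertible (mat 1 + B)"
  shows "cayley A = - cayley B"
proof (rule cayley_eqI)
  have eq: "A ** (mat 1 + B) = mat 1 + A"
    using assms(1) by (simp add: matrix_ring_simps)
  have BA: "B ** A = mat 1"
    using assms(1) by (rule matrix_right_inverse_imp_left)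
  show "invertible (mat 1 + A)"
    unfolding eq [symmetric] using assms BA by (intro invertible_mult) (auto simp: invertible_def)
  have "cayley B ** A = A ** cayley B"
    using assms BA by (intro cayley_commute) simp_all
  then have "- cayley B ** (A ** (mat 1 + B)) = - (A ** (cayley B ** (mat 1 + B)))"
    by (simp add: matrix_mul_assoc matrix_mult.minus_left)
  also have "\<dots> = mat 1 - A"
    by (simp add: cayley_mult_left [OF assms(2)] matrix_mult.diff_right assms(1))
  finally show "- cayley B ** (mat 1 + A) = mat 1 - A"
    by (simp add: eq)
qed

text \<open>The hypothesis \<open>double\<close> is the double-angle formula for the tangent: if
  \<open>Y\<close> is \<open>i\<close> times the tangent of an angle, then \<open>X\<close> is
  \<open>i\<close> times the tangent of twice that angle, and transforms are exponentials of the
  angles.\<close>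

lemma cayley_double:
  assumes inv: "invertible (mat 1 + X)" "invertible (mat 1 + Y)"
    and comm: "Y ** X = X ** Y"
    and double: "2 *\<^sub>R Y = X + X ** (Y ** Y)"
  shows "cayley Y ** cayley Y = cayley X"
proof (rule sym, rule cayley_eqI [OF inv(1)])
  let ?Q = "(mat 1 + Y) ** (mat 1 + Y)"
  have comm': "Y ** (X ** Z) = X ** (Y ** Z)" for Z
    by (simp add: matrix_mul_assoc comm)
  have XYY: "X ** (Y ** Y) = Y + Y - X"
    using double by (simp add: scaleR_2 algebra_simps)
  have "cayley Y ** ?Q = (mat 1 - Y) ** (mat 1 + Y)"
    by (simp add: matrix_mul_assoc cayley_mult_left [OF inv(2)])
  also have "\<dots> = (mat 1 + Y) ** (mat 1 - Y)"
    by (simp add: matrix_ring_simps)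
  finally have "cayley Y ** cayley Y ** ?Q = cayley Y ** ((mat 1 + Y) ** (mat 1 - Y))"
    by (simp flip: matrix_mul_assoc)
  also have "\<dots> = (mat 1 - Y) ** (mat 1 - Y)"
    by (simp add: matrix_mul_assoc cayley_mult_left [OF inv(2)])
  finally have sq: "cayley Y ** cayley Y ** ?Q = (mat 1 - Y) ** (mat 1 - Y)" .
  have Q: "invertible ?Q"
    using inv(2) inv(2) by (rule invertible_mult)
  have "(mat 1 + X) ** ?Q = ?Q ** (mat 1 + X)"
    by (simp add: matrix_ring_simps comm comm')
  then have "cayley Y ** cayley Y ** (mat 1 + X) ** ?Q = cayley Y ** cayley Y ** ?Q ** (mat 1 + X)"
    by (simp flip: matrix_mul_assoc)
  also have "\<dots> = (mat 1 - Y) ** (mat 1 - Y) ** (mat 1 + X)"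
    by (simp only: sq)
  \<comment> \<open>Substituting \<open>XYY\<close> reduces both sides to
    \<open>mat 1 + Y ** Y - 2 *\<^sub>R (X ** Y)\<close>.\<close>
  also have "\<dots> = (mat 1 - X) ** ?Q"
    by (simp add: matrix_ring_simps comm comm' XYY)
  finally have "cayley Y ** cayley Y ** (mat 1 + X) ** ?Q ** matrix_inv ?Q =
      (mat 1 - X) ** ?Q ** matrix_inv ?Q"
    by simp
  then show "cayley Y ** cayley Y ** (mat 1 + X) = mat 1 - X"
    using matrix_inv_inverse(1) [OF Q] by (simp flip: matrix_mul_assoc)
qed

lemma continuous_on_cayley:
  fixes f :: "'b::topological_space \<Rightarrow> 'a::conj_scalar^'n^'n"
  assumes "continuous_on S f" "\<And>x. x \<in> S \<Longrightarrow> invertible (mat 1 + f x)"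
  shows "continuous_on S (\<lambda>x. cayley (f x))"
  unfolding cayley_def using assms by (intro continuous_intros)

section \<open>Cayley transforms of skew-Hermitian matrices\<close>

lemma skew_inner:
  fixes X Z W :: "'a::conj_scalar^'n^'n"
  assumes "conj_transpose X = - X"
  shows "inner Z (X ** W) = - inner (X ** Z) W"
  using assms by (simp add: inner_matrix_mult_left matrix_mult.minus_left)

text \<open>A skew-Hermitian \<open>X\<close> satisfies \<open>inner Z (X ** Z) = 0\<close>, so
  pairing \<open>(mat 1 + X) ** Z = 0\<close> with \<open>Z\<close> leaves
  \<open>inner Z Z = 0\<close>.\<close>

lemma invertible_one_plus_skew:
  fixes X :: "'a::conj_scalar^'n^'n"
  assumes "conj_transpose X = - X"
  shows "invertible (mat 1 + X)"
proof (rule invertible_if_inj)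
  fix Z :: "'a^'n^'n"
  assume "(mat 1 + X) ** Z = 0"
  then have "Z + X ** Z = 0"
    by (simp add: matrix_mult.add_left)
  then have "inner Z (Z + X ** Z) = 0"
    by simp
  moreover have "inner Z (X ** Z) = 0"
    using skew_inner [OF assms, of Z Z] by (simp add: inner_commute)
  ultimately show "Z = 0"
    by (simp add: inner_add_right)
qed

text \<open>Replacing \<open>X\<close> by \<open>- X\<close> swaps numerator and denominator, so
  \<open>cayley (- X)\<close> is the inverse of \<open>cayley X\<close>; by skewness it is also its
  conjugate transpose.\<close>

lemma cayley_skew_unitary:
  fixes X :: "'a::conj_scalar^'n^'n"
  assumes "conj_transpose X = - X"
  shows "cayley X \<in> unitary_mats"
proof -
  have inv: "invertible (mat 1 + X)" "invertible (mat 1 + (- X))"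
    using assms by (intro invertible_one_plus_skew; simp add: conj_transpose_linear_simps)+
  have "(cayley X ** cayley (- X)) ** (mat 1 + (- X)) = cayley X ** (mat 1 + X)"
    using cayley_mult_left [OF inv(2)] by (simp flip: matrix_mul_assoc)
  also have "\<dots> = mat 1 + (- X)"
    by (simp add: cayley_mult_left [OF inv(1)])
  finally have "(cayley X ** cayley (- X)) ** (mat 1 + (- X)) ** matrix_inv (mat 1 + (- X)) =
      (mat 1 + (- X)) ** matrix_inv (mat 1 + (- X))"
    by (rule arg_cong)
  then have "cayley X ** cayley (- X) = mat 1"
    using matrix_inv_inverse(1) [OF inv(2)] by (simp flip: matrix_mul_assoc)
  then show ?thesis
    using assms by (simp add: unitary_mats_def conj_transpose_cayley [OF inv(1)])
qed

lemma cayley_skew_unitary_comp: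
  fixes X :: "'a::conj_scalar^'n^'n"
  assumes "conj_transpose X = - X"
  shows "cayley X \<in> unitary_comp"
proof (rule unitary_comp_memI)
  let ?p = "\<lambda>t::real. cayley (t *\<^sub>R X)"
  have skew: "conj_transpose (t *\<^sub>R X) = - (t *\<^sub>R X)" for t
    using assms by (simp add: conj_transpose_linear_simps)
  have "continuous_on {0..1} ?p"
    by (intro continuous_on_cayley continuous_intros invertible_one_plus_skew skew)
  then show "connected (?p ` {0..1})"
    by (intro connected_continuous_image) auto
  show "?p ` {0..1} \<subseteq> unitary_mats"
    using skew cayley_skew_unitary by blast
  show "mat 1 \<in> ?p ` {0..1}"
    by (rule rev_image_eqI [of 0])
       (auto simp: cayley_def intro!: matrix_inv_unique_right(2) [symmetric])
  show "cayley X \<in> ?p ` {0..1}"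
    by (rule rev_image_eqI [of 1]) auto
qed (rule mat_one_unitary_comp)

section \<open>The Cartan model\<close>

locale star_involution =
  fixes \<sigma> :: "'a::conj_scalar^'n^'n \<Rightarrow> 'a^'n^'n"
  assumes involutive_star_aut: "involutive_star_aut \<sigma>"
begin

lemma
  shows linear: "linear \<sigma>" and mat_one [simp]: "\<sigma> (mat 1) = mat 1"
    and mult: "\<sigma> (X ** Y) = \<sigma> X ** \<sigma> Y" and involutive [simp]: "\<sigma> (\<sigma> X) = X"
    and star: "\<sigma> (conj_transpose X) = conj_transpose (\<sigma> X)"
  using involutive_star_aut by (auto simp: involutive_star_aut_def)

lemmas linear_simps = linear_add [OF linear] linear_diff [OF linear] linear_neg [OF linear]
  linear_cmul [OF linear]

lemma continuous_on_comp:
  fixes f :: "'b::topological_space \<Rightarrow> 'a^'n^'n"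
  assumes "continuous_on S f"
  shows "continuous_on S (\<lambda>x. \<sigma> (f x))"
proof -
  have "bounded_linear \<sigma>"
    using linear by (simp only: linear_conv_bounded_linear)
  then show ?thesis
    using assms by (rule bounded_linear.continuous_on)
qed

lemma invertible_image: "invertible A \<Longrightarrow> invertible (\<sigma> A)"
proof (rule matrix_inv_unique_right)
  assume "invertible A"
  then show "\<sigma> A ** \<sigma> (matrix_inv A) = mat 1"
    by (simp add: matrix_inv_inverse(1) flip: mult)
qed

lemma image_cayley:
  assumes "invertible (mat 1 + X)"
  shows "\<sigma> (cayley X) = cayley (\<sigma> X)"
proof (rule sym, rule cayley_eqI)
  show "invertible (mat 1 + \<sigma> X)"
    using invertible_image [OF assms] by (simp add: linear_simps)
  have "\<sigma> (cayley X ** (mat 1 + X)) = mat 1 - \<sigma> X"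
    by (simp add: cayley_mult_left [OF assms] linear_simps)
  then show "\<sigma> (cayley X) ** (mat 1 + \<sigma> X) = mat 1 - \<sigma> X"
    by (simp add: mult linear_simps)
qed

lemma unitary_comp_image: "B \<in> unitary_comp \<Longrightarrow> \<sigma> B \<in> unitary_comp"
  using involutive_star_aut_image_unitary_comp [OF involutive_star_aut] by blast

lemma cartan_model_eq: "cartan_model \<sigma> = (\<lambda>B. B ** conj_transpose (\<sigma> B)) ` unitary_comp"
proof -
  have "matrix_inv (\<sigma> B) = conj_transpose (\<sigma> B)" if "B \<in> unitary_comp" for B
    using unitary_comp_image [OF that] unitary_comp_subset by (intro unitary_matsD) blast
  then show ?thesis
    by (force simp: cartan_model_def)
qed

lemma cartan_model_unitary:
  assumes "B \<in> cartan_model \<sigma>"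
  shows "B \<in> unitary_mats" "\<sigma> B = conj_transpose B"
proof -
  obtain D where D: "D \<in> unitary_comp" "B = D ** conj_transpose (\<sigma> D)"
    using assms by (auto simp: cartan_model_eq)
  then have "B \<in> unitary_comp"
    by (simp add: unitary_comp_mult conj_transpose_unitary_comp unitary_comp_image)
  then show "B \<in> unitary_mats"
    using unitary_comp_subset by blast
  show "\<sigma> B = conj_transpose B"
    by (simp add: D(2) mult star conj_transpose_mult)
qed

text \<open>The (-1)-eigenspace of \<open>\<sigma>\<close> on the Lie algebra of skew-Hermitian
  matrices, that is, the summand p of the Cartan decomposition and the tangent space of M at the
  identity.\<close>

definition antifixed_skew :: "('a^'n^'n) set"
  where "antifixed_skew = {X. conj_transpose X = - X \<and> \<sigma> X = - X}"

text \<open>With \<open>Y = X T\<close> the half-angle equation \<open>2 Y = X (1 + Y\<^sup>2)\<close> becomes \<open>T (2 + X\<^sup>* T X) = 1\<close>.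
  The map \<open>T \<mapsto> (2 + X\<^sup>* T X)\<^sup>-\<^sup>1\<close> preserves the compact convex set of bounded positive Hermitian
  matrices that are fixed by \<open>\<sigma>\<close> and commute with \<open>X\<close>, so Brouwer's theorem provides \<open>T\<close>.\<close>

lemma half_angle:
  assumes "X \<in> antifixed_skew"
  obtains Y where "Y \<in> antifixed_skew" "Y ** X = X ** Y" "2 *\<^sub>R Y = X + X ** (Y ** Y)"
proof -
  have skew: "conj_transpose X = - X" and anti: "\<sigma> X = - X"
    using assms by (auto simp: antifixed_skew_def)
  define P where "P T = 2 *\<^sub>R mat 1 - X ** (T ** X)" for T
  define D where "D = {T. conj_transpose T = T \<and> \<sigma> T = T \<and> T ** X = X ** T \<and>
    (\<forall>Z::'a^'n^'n. 0 \<le> inner Z (T ** Z))}"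
  \<comment> \<open>This radius comes from the bound \<open>lower\<close> below, applied to the
    inverse of \<open>P T\<close>.\<close>
  let ?r = "norm (mat 1 :: 'a^'n^'n)"
  have lower: "norm Z \<le> norm (P T ** Z)" if "T \<in> D" for T and Z :: "'a^'n^'n"
  proof (cases "Z = 0")
    case False
    \<comment> \<open>Moving one factor \<open>X\<close> across the inner product with a sign turns
      the quadratic term into the nonnegative form of \<open>T\<close> at
      \<open>X ** Z\<close>.\<close>
    have "inner Z (P T ** Z) = 2 * inner Z Z + inner (X ** Z) (T ** (X ** Z))"
      using skew_inner [OF skew, of Z "T ** (X ** Z)"]
      by (simp add: P_def matrix_ring_simps inner_diff_right)
    also have "\<dots> \<ge> 2 * inner Z Z"
      using that by (simp add: D_def)
    finally have "(norm Z)\<^sup>2 \<le> inner Z (P T ** Z)"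
      unfolding power2_norm_eq_inner using inner_ge_zero [of Z] by linarith
    also have "\<dots> \<le> norm Z * norm (P T ** Z)"
      by (rule norm_cauchy_schwarz)
    finally show ?thesis
      using False by (simp add: power2_eq_square)
  qed auto
  have inv: "invertible (P T)" if "T \<in> D" for T
  proof (rule invertible_if_inj)
    fix Z :: "'a^'n^'n"
    assume "P T ** Z = 0"
    with lower [OF that, of Z] show "Z = 0"
      by simp
  qed
  have inv_D: "matrix_inv (P T) \<in> D \<inter> cball 0 ?r" if T: "T \<in> D" for T
  proof -
    let ?R = "matrix_inv (P T)"
    note PR = matrix_inv_inverse [OF inv [OF T]]
    have T': "conj_transpose T = T" "\<sigma> T = T" "T ** X = X ** T"
      "\<And>Z :: 'a^'n^'n. 0 \<le> inner Z (T ** Z)"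
      using T by (auto simp: D_def)
    \<comment> \<open>Both \<open>conj_transpose\<close> and \<open>\<sigma>\<close> fix
      \<open>P T\<close>; each therefore turns \<open>?R\<close> into a right inverse of
      \<open>P T\<close>, which can only be \<open>?R\<close> itself.\<close>
    have "conj_transpose (P T) = P T"
      using T' skew by (simp add: P_def conj_transpose_linear_simps conj_transpose_mult matrix_ring_simps)
    then have "P T ** conj_transpose ?R = conj_transpose (?R ** P T)"
      by (simp add: conj_transpose_mult)
    then have "conj_transpose ?R = ?R"
      using PR by (intro matrix_inv_unique_right(2) [symmetric]) simp
    moreover have "\<sigma> (P T) = P T"
      using T' anti by (simp add: P_def linear_simps mult matrix_ring_simps)
    then have "P T ** \<sigma> ?R = \<sigma> (P T ** ?R)"
      by (simp add: mult)
    then have "\<sigma> ?R = ?R"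
      using PR by (intro matrix_inv_unique_right(2) [symmetric]) simp
    moreover have "P T ** X = X ** P T"
      using T'(3) by (simp add: P_def matrix_ring_simps)
    then have "?R ** X = X ** ?R"
      by (intro matrix_inv_commute inv T)
    \<comment> \<open>With \<open>W = ?R ** Z\<close> this is the form of \<open>P T\<close> at
      \<open>W\<close>, whose positivity was seen above.\<close>
    moreover have "0 \<le> inner Z (?R ** Z)" for Z :: "'a^'n^'n"
    proof -
      define W where "W = ?R ** Z"
      have Z: "Z = P T ** W"
        by (simp add: W_def matrix_mul_assoc PR)
      have "inner Z W = 2 * inner W W + inner (X ** W) (T ** (X ** W))"
        using skew_inner [OF skew, of W "T ** (X ** W)"]
        by (simp add: Z P_def matrix_ring_simps inner_diff_right inner_diff_left inner_commute)
      also have "\<dots> \<ge> 0"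
        using T'(4) by simp
      finally show ?thesis
        by (simp add: W_def)
    qed
    moreover have "norm ?R \<le> ?r"
      using lower [OF T, of ?R] by (simp add: PR)
    ultimately show ?thesis
      by (simp add: D_def)
  qed
  have "closed D"
    unfolding D_def
    by (intro closed_Collect_conj closed_Collect_all closed_Collect_eq closed_Collect_le
        continuous_intros continuous_on_comp)
  then have compact: "compact (D \<inter> cball 0 ?r)"
    by (intro closed_Int_compact compact_cball)
  have convex: "convex (D \<inter> cball 0 ?r)"
  proof (intro convex_Int convex_cball convexI)
    fix S T :: "'a^'n^'n" and u v :: real
    assume "S \<in> D" "T \<in> D" "0 \<le> u" "0 \<le> v"
    then show "u *\<^sub>R S + v *\<^sub>R T \<in> D"
      by (simp add: D_def conj_transpose_linear_simps linear_simps matrix_ring_simps inner_add_right)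
  qed
  have "0 \<in> D \<inter> cball 0 ?r"
    by (simp add: D_def linear_0 [OF linear] linear_0 [OF linear_conj_transpose])
  then have nonempty: "D \<inter> cball 0 ?r \<noteq> {}"
    by blast
  have cont: "continuous_on (D \<inter> cball 0 ?r) (\<lambda>T. matrix_inv (P T))"
  proof (intro continuous_on_matrix_inv)
    show "continuous_on (D \<inter> cball 0 ?r) P"
      unfolding P_def by (intro continuous_intros)
  qed (use inv in blast)
  have maps: "(\<lambda>T. matrix_inv (P T)) \<in> D \<inter> cball 0 ?r \<rightarrow> D \<inter> cball 0 ?r"
    using inv_D by blast
  obtain T where "T \<in> D \<inter> cball 0 ?r" and fixed: "matrix_inv (P T) = T"
    by (rule brouwer [OF compact convex nonempty cont maps])
  then have T: "T \<in> D"
    by simp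
  have T': "conj_transpose T = T" "\<sigma> T = T" "T ** X = X ** T"
    using T by (auto simp: D_def)
  have "T ** P T = mat 1"
    using matrix_inv_inverse(2) [OF inv [OF T]] fixed by simp
  then have TT: "2 *\<^sub>R T - T ** (X ** (T ** X)) = mat 1"
    by (simp add: P_def matrix_ring_simps)
  show ?thesis
  proof (rule that [of "X ** T"])
    show "X ** T \<in> antifixed_skew"
      using T' skew anti
      by (simp add: antifixed_skew_def conj_transpose_mult mult matrix_ring_simps)
    show "X ** T ** X = X ** (X ** T)"
      by (simp add: T'(3) flip: matrix_mul_assoc)
    \<comment> \<open>Multiplying the fixed-point equation by \<open>X\<close> and moving
      \<open>T\<close> past \<open>X\<close> gives the half-angle equation.\<close>
    have "X ** (2 *\<^sub>R T) = X ** (mat 1 + T ** (X ** (T ** X)))"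
      using TT by (simp add: algebra_simps)
    then show "2 *\<^sub>R (X ** T) = X + X ** (X ** T ** (X ** T))"
      by (simp add: matrix_ring_simps T'(3) matrix_mul_assoc [of T X])
  qed
qed

section \<open>The Cayley chart of M at the identity\<close>

lemma cayley_in_cartan_model:
  assumes "X \<in> antifixed_skew"
  shows "cayley X \<in> cartan_model \<sigma>"
proof -
  obtain Y where Y: "Y \<in> antifixed_skew" "Y ** X = X ** Y" "2 *\<^sub>R Y = X + X ** (Y ** Y)"
    using half_angle [OF assms] by blast
  have skew: "conj_transpose X = - X" "conj_transpose Y = - Y" and anti: "\<sigma> Y = - Y"
    using assms Y(1) by (auto simp: antifixed_skew_def)
  note inv = invertible_one_plus_skew [OF skew(1)] invertible_one_plus_skew [OF skew(2)]
  \<comment> \<open>Both maps send \<open>Y\<close> to \<open>- Y\<close>. Hence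
    \<open>conj_transpose (\<sigma> (cayley Y))\<close> is \<open>cayley Y\<close>, and the square
    has the form required of an element of M.\<close>
  have "\<sigma> (cayley Y) = conj_transpose (cayley Y)"
    by (simp add: image_cayley [OF inv(2)] conj_transpose_cayley [OF inv(2)] skew anti)
  then have "cayley X = cayley Y ** conj_transpose (\<sigma> (cayley Y))"
    using cayley_double [OF inv Y(2,3)] by simp
  then show ?thesis
    unfolding cartan_model_eq using cayley_skew_unitary_comp [OF skew(2)] by (rule image_eqI)
qed

lemma homeomorphic_cartan_Omega_mat_one: "antifixed_skew homeomorphic cartan_Omega \<sigma> (mat 1)"
proof -
  have inv: "invertible (mat 1 + X)" if "X \<in> antifixed_skew" for X
    using that by (intro invertible_one_plus_skew) (simp add: antifixed_skew_def)
  have to: "cayley X \<in> cartan_Omega \<sigma> (mat 1)" if "X \<in> antifixed_skew" for X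
    using cayley_in_cartan_model [OF that] invertible_one_plus_cayley [OF inv [OF that]]
    by (simp add: cartan_Omega_def)
  have inv': "invertible (mat 1 + B)" if "B \<in> cartan_Omega \<sigma> (mat 1)" for B
    using that by (simp add: cartan_Omega_def)
  have fro: "cayley B \<in> antifixed_skew" if "B \<in> cartan_Omega \<sigma> (mat 1)" for B
  proof -
    have "B \<in> cartan_model \<sigma>"
      using that by (simp add: cartan_Omega_def)
    note B = cartan_model_unitary [OF this]
    \<comment> \<open>Since \<open>\<sigma> B\<close> is also \<open>conj_transpose B\<close>, this
      one equation yields both skewness and the sign change under \<open>\<sigma>\<close>.\<close>
    have "cayley (conj_transpose B) = - cayley B"
      using unitary_matsD(2) [OF B(1)] inv' [OF that] by (rule cayley_inverse)
    then show ?thesis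
      by (simp add: antifixed_skew_def image_cayley [OF inv' [OF that]]
          conj_transpose_cayley [OF inv' [OF that]] B(2))
  qed
  show ?thesis
  proof (rule homeomorphicI)
    show "cayley ` antifixed_skew = cartan_Omega \<sigma> (mat 1)"
    proof (intro subset_antisym subsetI)
      fix B assume "B \<in> cartan_Omega \<sigma> (mat 1)"
      then show "B \<in> cayley ` antifixed_skew"
        using fro cayley_cayley [OF inv'] by (intro image_eqI [of _ _ "cayley B"]) simp_all
    qed (use to in auto)
    show "cayley ` cartan_Omega \<sigma> (mat 1) = antifixed_skew"
    proof (intro subset_antisym subsetI)
      fix X assume "X \<in> antifixed_skew"
      then show "X \<in> cayley ` cartan_Omega \<sigma> (mat 1)"
        using to cayley_cayley [OF inv] by (intro image_eqI [of _ _ "cayley X"]) simp_all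
    qed (use fro in auto)
  qed (use inv inv' in \<open>auto simp: cayley_cayley intro!: continuous_on_cayley continuous_on_id\<close>)
qed

text \<open>If \<open>B\<close> comes from \<open>D\<close>, its translate comes from
  \<open>C ** D\<close>, so M is preserved. The sum \<open>A + B\<close> is only multiplied on both
  sides by unitary matrices, so it stays invertible.\<close>

lemma cartan_Omega_translate:
  assumes C: "C \<in> unitary_comp" and B: "B \<in> cartan_Omega \<sigma> A"
  shows "C ** B ** conj_transpose (\<sigma> C) \<in> cartan_Omega \<sigma> (C ** A ** conj_transpose (\<sigma> C))"
proof -
  obtain D where D: "D \<in> unitary_comp" "B = D ** conj_transpose (\<sigma> D)"
    using B by (auto simp: cartan_Omega_def cartan_model_eq)
  have "C ** B ** conj_transpose (\<sigma> C) = (C ** D) ** conj_transpose (\<sigma> (C ** D))"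
    by (simp add: D(2) mult conj_transpose_mult flip: matrix_mul_assoc)
  then have "C ** B ** conj_transpose (\<sigma> C) \<in> cartan_model \<sigma>"
    unfolding cartan_model_eq using unitary_comp_mult [OF C D(1)] by (rule image_eqI)
  moreover have "invertible (C ** (A + B) ** conj_transpose (\<sigma> C))"
  proof (intro invertible_mult)
    show "invertible C"
      using C unitary_comp_subset by (blast intro: unitary_matsD)
    show "invertible (conj_transpose (\<sigma> C))"
      using C unitary_comp_subset
      by (blast intro: unitary_matsD conj_transpose_unitary_comp unitary_comp_image)
    show "invertible (A + B)"
      using B by (simp add: cartan_Omega_def)
  qed
  ultimately show ?thesis
    by (simp add: cartan_Omega_def matrix_mult.add_left matrix_mult.add_right)
qed

lemma homeomorphic_cartan_Omega:
  assumes "A \<in> cartan_model \<sigma>"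
  shows "cartan_Omega \<sigma> (mat 1) homeomorphic cartan_Omega \<sigma> A"
proof -
  obtain C where C: "C \<in> unitary_comp" "A = C ** conj_transpose (\<sigma> C)"
    using assms by (auto simp: cartan_model_eq)
  define f where "f B = C ** B ** conj_transpose (\<sigma> C)" for B
  \<comment> \<open>This is the translation by \<open>conj_transpose C\<close>, the inverse of
    \<open>C\<close>, so the translation lemma applies to it as well.\<close>
  define g where "g B = conj_transpose C ** B ** \<sigma> C" for B
  have "C \<in> unitary_mats" "\<sigma> C \<in> unitary_mats"
    using C(1) unitary_comp_image unitary_comp_subset by blast+
  note CC = this [THEN unitary_matsD(1)] this [THEN unitary_matsD(2)]
  have CC': "C ** (conj_transpose C ** Z) = Z" "conj_transpose C ** (C ** Z) = Z" for Z
    using CC by (simp_all add: matrix_mul_assoc)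
  have gf: "g (f B) = B" and fg: "f (g B) = B" for B
    using CC by (simp_all add: f_def g_def CC' flip: matrix_mul_assoc)
  have gA: "g A = mat 1" and f1: "f (mat 1) = A"
    using CC by (simp_all add: f_def g_def C(2) CC' flip: matrix_mul_assoc)
  have to: "f B \<in> cartan_Omega \<sigma> A" if "B \<in> cartan_Omega \<sigma> (mat 1)" for B
    using cartan_Omega_translate [OF C(1) that] f1 by (simp add: f_def)
  have fro: "g B \<in> cartan_Omega \<sigma> (mat 1)" if "B \<in> cartan_Omega \<sigma> A" for B
    using cartan_Omega_translate [OF conj_transpose_unitary_comp [OF C(1)] that] gA
    by (simp add: g_def star)
  show ?thesis
  proof (rule homeomorphicI)
    show "f ` cartan_Omega \<sigma> (mat 1) = cartan_Omega \<sigma> A"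
      using to fro fg by (auto intro!: image_eqI [of _ f "g _"])
    show "g ` cartan_Omega \<sigma> A = cartan_Omega \<sigma> (mat 1)"
      using to fro gf by (auto intro!: image_eqI [of _ g "f _"])
    show "continuous_on (cartan_Omega \<sigma> (mat 1)) f" "continuous_on (cartan_Omega \<sigma> A) g"
      unfolding f_def g_def by (intro continuous_intros)+
  qed (simp_all add: gf fg)
qed

theorem cartan_Omega_contractible_open:
  assumes "A \<in> cartan_model \<sigma>"
  shows "openin (top_of_set (cartan_model \<sigma>)) (cartan_Omega \<sigma> A)"
    and "cartan_Omega \<sigma> A \<noteq> {}" and "contractible (cartan_Omega \<sigma> A)"
proof -
  have "open ((\<lambda>B. A + B) -` {B. invertible B})"
    by (intro open_vimage open_invertible continuous_intros)
  then have "openin (top_of_set (cartan_model \<sigma>))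
      (cartan_model \<sigma> \<inter> (\<lambda>B. A + B) -` {B. invertible B})"
    by (rule openin_open_Int)
  also have "cartan_model \<sigma> \<inter> (\<lambda>B. A + B) -` {B. invertible B} = cartan_Omega \<sigma> A"
    by (auto simp: cartan_Omega_def)
  finally show "openin (top_of_set (cartan_model \<sigma>)) (cartan_Omega \<sigma> A)" .
  have hom: "antifixed_skew homeomorphic cartan_Omega \<sigma> A"
    using homeomorphic_cartan_Omega_mat_one homeomorphic_cartan_Omega [OF assms]
    by (rule homeomorphic_trans)
  \<comment> \<open>The empty set counts as contractible, so nonemptiness is proved separately; the
    zero matrix corresponds to \<open>A\<close> itself.\<close>
  have "0 \<in> antifixed_skew"
    by (simp add: antifixed_skew_def linear_0 [OF linear] linear_0 [OF linear_conj_transpose])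
  then show "cartan_Omega \<sigma> A \<noteq> {}"
    using homeomorphic_empty(2) [of "antifixed_skew"] hom by auto
  have "convex antifixed_skew"
    by (intro convexI)
       (simp add: antifixed_skew_def conj_transpose_linear_simps linear_simps)
  then show "contractible (cartan_Omega \<sigma> A)"
    using homeomorphic_contractible [OF convex_imp_contractible hom] by simp
qed

end

theorem theorem3p4:
  shows "(\<forall>(\<sigma> :: real^'n^'n \<Rightarrow> real^'n^'n) A.
            involutive_star_aut \<sigma> \<and> A \<in> cartan_model \<sigma> \<longrightarrow>
              openin (top_of_set (cartan_model \<sigma>)) (cartan_Omega \<sigma> A) \<and>
              cartan_Omega \<sigma> A \<noteq> {} \<and> contractible (cartan_Omega \<sigma> A)) \<and>
         (\<forall>(\<sigma> :: complex^'n^'n \<Rightarrow> complex^'n^'n) A.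
            involutive_star_aut \<sigma> \<and> A \<in> cartan_model \<sigma> \<longrightarrow>
              openin (top_of_set (cartan_model \<sigma>)) (cartan_Omega \<sigma> A) \<and>
              cartan_Omega \<sigma> A \<noteq> {} \<and> contractible (cartan_Omega \<sigma> A)) \<and>
         (\<forall>(\<sigma> :: quat^'n^'n \<Rightarrow> quat^'n^'n) A.
            involutive_star_aut \<sigma> \<and> A \<in> cartan_model \<sigma> \<longrightarrow>
              openin (top_of_set (cartan_model \<sigma>)) (cartan_Omega \<sigma> A) \<and>
              cartan_Omega \<sigma> A \<noteq> {} \<and> contractible (cartan_Omega \<sigma> A))"
proof (intro conjI allI impI; elim conjE)
qed (rule star_involution.cartan_Omega_contractible_open, rule star_involution.intro, assumption+)+

end
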